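(* Let $f$ be a minimal homeomorphism on a compact metric space $X$. Let $F=\{f,\mathrm{id}_X\}$ and let $G$ be the semigroup generated by $F$. Then $h_H(G,F)=0$.
   Context: Compact metric spaces are non-empty; $d$ denotes the metric of $X$. A homeomorphism $f:X\to X$ is minimal if every orbit is dense in $X$ (equivalently, there is no non-empty proper closed subset $Y$ with $f(Y)= Y$). For a finite set $F=\{f_1,\ldots,f_p\}$ of continuous self-maps of $X$, put $F^0=\{\mathrm{id}_X\}$ and, for $n\ge 1$, $F^n=\{g_n\circ g_{n-1}\circ\cdots\circ g_1 : g_j\in\{f_1,\ldots,f_p\} \text{ for all } 1\le j\le n\}$. For $x\in X$ and $n\ge 0$ put $F^n(x)=\{g(x): g\in F^n\}$. For non-empty compact $A,B\subseteq X$ the Hausdorff metric is $d_H(A,B)=\max\{\sup_{a\in A}\inf_{b\in B}d(a,b),\ \sup_{b\in B}\inf_{a\in A}d(a,b)\}$. For $x,y\in X$ put $d_H^n(x,y)=\max_{0\le i\le n} d_H(F^i(x),F^i(y))$. For $\epsilon>0$, a subset $M\subseteq X$ is a Hausdorff metric $(n,\epsilon)$-spanning set of $X$ with respect to $F$ if for each $x\in X$ there is $y\in M$ with $d_H^n(x,y)<\epsilon$. Let $r_H(n,\epsilon,X,F)$ be the minimal cardinality of such a set (a finite positive integer). The Hausdorff metric entropy of the semigroup $G$ generated by $F$ is $$h_H(G,F)=\lim_{\epsilon\to 0^+}\limsup_{n\to+\infty}\frac1n\log r_H(n,\epsilon,X,F).$$ *)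

theory Defs
  imports "HOL-Analysis.Analysis"
begin

text \<open>
  A metric space is a set \<open>X\<close> in a type of class \<open>metric_space\<close>. A self-map of \<open>X\<close> is a total
  function on the type; its values outside \<open>X\<close> play no role.
\<close>

definition full_orbit :: "'a set \<Rightarrow> ('a \<Rightarrow> 'a) \<Rightarrow> 'a \<Rightarrow> 'a set" where
  "full_orbit X f x = range (\<lambda>n. (f ^^ n) x) \<union> range (\<lambda>n. (inv_into X f ^^ n) x)"

definition minimal_homeomorphism :: "'a::topological_space set \<Rightarrow> ('a \<Rightarrow> 'a) \<Rightarrow> bool" where
  "minimal_homeomorphism X f \<longleftrightarrow>
     (\<exists>g. homeomorphism X X f g) \<and> (\<forall>x\<in>X. X \<subseteq> closure (full_orbit X f x))"

primrec compositions :: "('a \<Rightarrow> 'a) set \<Rightarrow> nat \<Rightarrow> ('a \<Rightarrow> 'a) set" where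
  "compositions F 0 = {id}"
| "compositions F (Suc n) = {g \<circ> h | g h. g \<in> F \<and> h \<in> compositions F n}"

definition images :: "('a \<Rightarrow> 'a) set \<Rightarrow> nat \<Rightarrow> 'a \<Rightarrow> 'a set" where
  "images F n x = (\<lambda>g. g x) ` compositions F n"

text \<open>Used for non-empty compact sets only, where all suprema and infima are attained.\<close>

definition hausdorff_dist :: "'a::metric_space set \<Rightarrow> 'a set \<Rightarrow> real" where
  "hausdorff_dist A B =
     max (SUP a\<in>A. INF b\<in>B. dist a b) (SUP b\<in>B. INF a\<in>A. dist a b)"

definition hausdorff_dist_upto :: "('a::metric_space \<Rightarrow> 'a) set \<Rightarrow> nat \<Rightarrow> 'a \<Rightarrow> 'a \<Rightarrow> real" where
  "hausdorff_dist_upto F n x y =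
     Max ((\<lambda>i. hausdorff_dist (images F i x) (images F i y)) ` {0..n})"

definition hausdorff_spanning ::
    "'a::metric_space set \<Rightarrow> ('a \<Rightarrow> 'a) set \<Rightarrow> nat \<Rightarrow> real \<Rightarrow> 'a set \<Rightarrow> bool" where
  "hausdorff_spanning X F n \<epsilon> M \<longleftrightarrow>
     M \<subseteq> X \<and> (\<forall>x\<in>X. \<exists>y\<in>M. hausdorff_dist_upto F n x y < \<epsilon>)"

text \<open>
  Finite spanning sets exist for compact \<open>X\<close> and finite \<open>F\<close> consisting of continuous self-maps.
  Finiteness must be required explicitly, because \<open>card\<close> is \<open>0\<close> on infinite sets.
\<close>

definition min_spanning_card ::
    "'a::metric_space set \<Rightarrow> ('a \<Rightarrow> 'a) set \<Rightarrow> nat \<Rightarrow> real \<Rightarrow> nat" where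
  "min_spanning_card X F n \<epsilon> =
     (LEAST k. \<exists>M. finite M \<and> card M = k \<and> hausdorff_spanning X F n \<epsilon> M)"

text \<open>
  The Hausdorff metric entropy of the semigroup generated by \<open>F\<close> is computed from the generating
  set \<open>F\<close> alone, so the semigroup is not a separate argument. The limit exists because the upper
  limit is antimonotone in \<open>\<epsilon>\<close>; it may be infinite for general \<open>F\<close>.
\<close>

definition hausdorff_entropy ::
    "'a::metric_space set \<Rightarrow> ('a \<Rightarrow> 'a) set \<Rightarrow> ereal" where
  "hausdorff_entropy X F =
     Lim (at_right 0)
       (\<lambda>\<epsilon>. limsup (\<lambda>n. ereal (ln (real (min_spanning_card X F n \<epsilon>)) / real n)))"

end

theory Submission
  imports Defs
begin

text \<open>
  By minimality and compactness there is, for every \<open>\<epsilon>\<close>, a single \<open>N\<close> such that every forward orbit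
  segment of length \<open>N\<close> is \<open>\<epsilon>\<close>-dense in \<open>X\<close>. As \<open>{f, id}\<^sup>i(x)\<close> is the segment
  \<open>x, f(x), \<dots>, f\<^sup>i(x)\<close>, the Hausdorff distance of two such segments is at most \<open>\<epsilon>\<close> as soon as
  \<open>i \<ge> N\<close>. Only the times \<open>i < N\<close> remain, and these are controlled by uniform continuity, so one
  finite net is spanning for all \<open>n\<close> and the spanning numbers are bounded in \<open>n\<close>.
\<close>

lemma hausdorff_dist_le:
  assumes "A \<noteq> {}" "B \<noteq> {}"
    and AB: "\<And>a. a \<in> A \<Longrightarrow> \<exists>b\<in>B. dist a b \<le> e"
    and BA: "\<And>b. b \<in> B \<Longrightarrow> \<exists>a\<in>A. dist a b \<le> e"
  shows "hausdorff_dist A B \<le> e"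
proof -
  have "(SUP a\<in>A. INF b\<in>B. dist a b) \<le> e"
  proof (rule cSUP_least[OF \<open>A \<noteq> {}\<close>])
    fix a assume "a \<in> A"
    then obtain b where "b \<in> B" "dist a b \<le> e" using AB by blast
    then show "(INF b\<in>B. dist a b) \<le> e"
      by (intro cINF_lower2[of _ B b]) (auto intro!: bdd_belowI2[of _ 0])
  qed
  moreover have "(SUP b\<in>B. INF a\<in>A. dist a b) \<le> e"
  proof (rule cSUP_least[OF \<open>B \<noteq> {}\<close>])
    fix b assume "b \<in> B"
    then obtain a where "a \<in> A" "dist a b \<le> e" using BA by blast
    then show "(INF a\<in>A. dist a b) \<le> e"
      by (intro cINF_lower2[of _ A a]) (auto intro!: bdd_belowI2[of _ 0])
  qed
  ultimately show ?thesis by (simp add: hausdorff_dist_def)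
qed

text \<open>A word of length \<open>n\<close> in the letters \<open>f\<close> and \<open>id\<close>
  collapses to \<open>f ^^ k\<close>, where \<open>k\<close> counts the letters \<open>f\<close>;
  each \<open>k\<close> from 0 to \<open>n\<close> occurs.\<close>

lemma compositions_insert_id: "compositions {f, id} n = (\<lambda>k. f ^^ k) ` {..n}"
proof (induction n)
  case 0
  then show ?case by (simp add: id_def)
next
  case (Suc n)
  have "compositions {f, id} (Suc n) = (\<lambda>h. f \<circ> h) ` compositions {f, id} n \<union> (\<lambda>h. id \<circ> h) ` compositions {f, id} n"
    \<comment> \<open>Simplifying \<open>id \<circ> h\<close> to \<open>h\<close> would hide the
      factor \<open>id\<close> that shows membership in the set of compositions.\<close>
    by (auto simp del: id_o id_comp)
  also have "\<dots> = (\<lambda>k. f ^^ Suc k) ` {..n} \<union> (\<lambda>k. f ^^ k) ` {..n}"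
    by (simp add: Suc image_image del: image_comp)
  also have "(\<lambda>k. f ^^ Suc k) ` {..n} = (\<lambda>k. f ^^ k) ` (Suc ` {..n})"
    by (simp add: image_image)
  also have "\<dots> \<union> (\<lambda>k. f ^^ k) ` {..n} = (\<lambda>k. f ^^ k) ` (Suc ` {..n} \<union> {..n})"
    by (simp add: image_Un)
  also have "Suc ` {..n} \<union> {..n} = {..Suc n}"
    using atMost_Suc_eq_insert_0[of n] by auto
  finally show ?case .
qed

lemma images_insert_id: "images {f, id} n x = (\<lambda>k. (f ^^ k) x) ` {..n}"
  by (simp add: images_def compositions_insert_id image_image)

lemma funpow_mem:
  assumes "f ` X \<subseteq> X" "x \<in> X"
  shows "(f ^^ n) x \<in> X"
  using assms by (induction n) auto

lemma continuous_on_funpow: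
  assumes "continuous_on X f" "f ` X \<subseteq> X"
  shows "continuous_on X (f ^^ n)"
proof (induction n)
  case 0
  then show ?case by (simp add: id_def)
next
  case (Suc n)
  have "(f ^^ n) ` X \<subseteq> X" using funpow_mem[OF assms(2)] by blast
  then have "continuous_on X (f \<circ> f ^^ n)"
    using Suc assms(1) by (intro continuous_on_compose) (auto intro: continuous_on_subset)
  then show ?case by simp
qed

text \<open>Turns a backward iterate of a point far along a forward orbit into a forward iterate of
  its start. A left inverse on \<open>X\<close> suffices, since the orbit stays in
  \<open>X\<close>.\<close>

lemma funpow_inverse_add:
  assumes "\<And>x. x \<in> X \<Longrightarrow> g (f x) = x" "f ` X \<subseteq> X" "x \<in> X"
  shows "(g ^^ n) ((f ^^ (n + m)) x) = (f ^^ m) x"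
proof (induction n)
  case (Suc n)
  have "(g ^^ Suc n) ((f ^^ (Suc n + m)) x) = (g ^^ n) (g (f ((f ^^ (n + m)) x)))"
    by (simp add: funpow_swap1)
  also have "g (f ((f ^^ (n + m)) x)) = (f ^^ (n + m)) x"
    using assms funpow_mem by metis
  finally show ?case using Suc by simp
qed simp

text \<open>
  Compactness bounds the times at which a two-sided orbit visits a ball by some \<open>N\<close> in absolute
  value; starting from \<open>f\<^sup>N(x)\<close> instead of \<open>x\<close> makes all these times non-negative.
\<close>

lemma minimal_forward_visit:
  fixes X :: "'a::metric_space set"
  assumes X: "compact X" and min: "minimal_homeomorphism X f" and "z \<in> X" "e > 0"
  shows "\<exists>N. \<forall>x\<in>X. \<exists>k\<le>N. dist ((f ^^ k) x) z < e"
proof -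
  \<comment> \<open>\<open>full_orbit\<close> is built from \<open>inv_into\<close>, whereas the
    homeomorphism supplies \<open>g\<close>. The two agree on \<open>X\<close>, and so
    \<open>h\<close> inherits continuity there.\<close>
  define h where "h = inv_into X f"
  obtain g where g: "homeomorphism X X f g" using min by (auto simp: minimal_homeomorphism_def)
  have fX: "continuous_on X f" "f ` X = X" and gX: "continuous_on X g" "g ` X = X"
    and gf: "\<And>x. x \<in> X \<Longrightarrow> g (f x) = x"
    using g by (auto simp: homeomorphism_def)
  have inj: "inj_on f X" using gf by (metis inj_onI)
  have hf: "h (f x) = x" if "x \<in> X" for x
    using inj that by (simp add: h_def)
  have hg: "h x = g x" if "x \<in> X" for x
    using hf gf that fX(2) by (metis imageE)
  have hX: "continuous_on X h" "h ` X \<subseteq> X"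
    using gX hg by (auto simp: continuous_on_eq[OF gX(1)])
  note fn = continuous_on_funpow[OF fX(1) equalityD1[OF fX(2)]]
    funpow_mem[OF equalityD1[OF fX(2)]]
  note hn = continuous_on_funpow[OF hX] funpow_mem[OF hX(2)]
  \<comment> \<open>The points of \<open>X\<close> that lie in the ball at time \<open>n\<close> or
    at time \<open>-n\<close>. Density of the two-sided orbits makes these relatively open sets a
    cover.\<close>
  define U where "U n = (X \<inter> (f ^^ n) -` ball z e) \<union> (X \<inter> (h ^^ n) -` ball z e)" for n
  have open_U: "openin (top_of_set X) (U n)" for n
    unfolding U_def using fn(1)[of n] hn(1)[of n]
    by (intro openin_Un continuous_openin_preimage_gen) auto
  have "X \<subseteq> (\<Union>n. U n)"
  proof
    fix x assume x: "x \<in> X"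
    then have "z \<in> closure (full_orbit X f x)"
      using min \<open>z \<in> X\<close> by (auto simp: minimal_homeomorphism_def)
    then obtain y where y: "y \<in> full_orbit X f x" "dist y z < e"
      using \<open>e > 0\<close> closure_approachable by blast
    then show "x \<in> (\<Union>n. U n)"
      using x by (auto simp: full_orbit_def U_def dist_commute simp flip: h_def)
  qed
  then obtain D where D: "D \<subseteq> range U" "finite D" "X \<subseteq> \<Union>D"
    using X open_U unfolding compact_eq_openin_cover by (metis (no_types, lifting) imageE)
  then obtain I where I: "finite I" "D = U ` I"
    by (meson finite_subset_image)
  \<comment> \<open>Inserting 0 keeps \<open>Max\<close> well defined without a proof that
    \<open>I\<close> is non-empty.\<close>
  define N where "N = Max (insert 0 I)"
  have N: "n \<le> N" if "n \<in> I" for n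
    using I that by (simp add: N_def)
  show ?thesis
  proof (rule exI[of _ "N + N"], intro ballI)
    fix x assume x: "x \<in> X"
    then have "(f ^^ N) x \<in> X" using fn(2) by blast
    then obtain n where n: "n \<in> I" "(f ^^ N) x \<in> U n" using D(3) I by blast
    show "\<exists>k\<le>N + N. dist ((f ^^ k) x) z < e"
    proof (cases "dist ((f ^^ n) ((f ^^ N) x)) z < e")
      case True
      then show ?thesis using N[OF n(1)] by (intro exI[of _ "n + N"]) (simp add: funpow_add)
    next
      case False
      then have "dist ((h ^^ n) ((f ^^ N) x)) z < e"
        using n by (auto simp: U_def dist_commute)
      moreover have "(h ^^ n) ((f ^^ N) x) = (f ^^ (N - n)) x"
        using funpow_inverse_add[of X h f x n "N - n"] hf fX x N[OF n(1)] by simp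
      ultimately show ?thesis by (intro exI[of _ "N - n"]) auto
    qed
  qed
qed

text \<open>The visiting time so far depends on the target. Taking the maximum over a finite
  \<open>e / 2\<close>-net of targets removes this dependence, at the cost of one triangle
  inequality.\<close>

lemma minimal_uniformly_dense_segments:
  fixes X :: "'a::metric_space set"
  assumes X: "compact X" and min: "minimal_homeomorphism X f" and "e > 0"
  shows "\<exists>N. \<forall>x\<in>X. \<forall>z\<in>X. \<exists>k\<le>N. dist ((f ^^ k) x) z < e"
proof -
  obtain Z where Z: "finite Z" "Z \<subseteq> X" "X \<subseteq> (\<Union>z\<in>Z. ball z (e / 2))"
    using seq_compact_imp_totally_bounded[OF compact_imp_seq_compact[OF X]] \<open>e > 0\<close>
    by (meson half_gt_zero)
  have "\<exists>N. \<forall>x\<in>X. \<exists>k\<le>N. dist ((f ^^ k) x) z < e / 2" if "z \<in> Z" for z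
    using minimal_forward_visit[OF X min, of z "e / 2"] that Z(2) \<open>e > 0\<close> by auto
  then obtain M where M: "\<forall>z\<in>Z. \<forall>x\<in>X. \<exists>k\<le>M z. dist ((f ^^ k) x) z < e / 2"
    using bchoice[of Z "\<lambda>z N. \<forall>x\<in>X. \<exists>k\<le>N. dist ((f ^^ k) x) z < e / 2"] by blast
  show ?thesis
  proof (rule exI[of _ "Max (M ` Z)"], intro ballI)
    fix x z assume "x \<in> X" "z \<in> X"
    then obtain w where w: "w \<in> Z" "dist w z < e / 2" using Z by auto
    then obtain k where k: "k \<le> M w" "dist ((f ^^ k) x) w < e / 2" using M \<open>x \<in> X\<close> by blast
    have "k \<le> Max (M ` Z)" using k w Z by (meson Max_ge finite_imageI imageI le_trans)
    moreover have "dist ((f ^^ k) x) z < e"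
      using dist_triangle_half_r[of w _ e] k w by (metis dist_commute)
    ultimately show "\<exists>k\<le>Max (M ` Z). dist ((f ^^ k) x) z < e" by blast
  qed
qed

text \<open>Only finitely many iterates are involved, each uniformly continuous on the compact set,
  so the least of their moduli serves all.\<close>

lemma uniformly_equicontinuous_funpow:
  fixes X :: "'a::metric_space set"
  assumes "compact X" "continuous_on X f" "f ` X \<subseteq> X" "e > 0"
  shows "\<exists>d>0. \<forall>x\<in>X. \<forall>y\<in>X. \<forall>k\<le>N. dist x y < d \<longrightarrow> dist ((f ^^ k) x) ((f ^^ k) y) < e"
proof -
  have "\<exists>d>0. \<forall>x\<in>X. \<forall>y\<in>X. dist x y < d \<longrightarrow> dist ((f ^^ k) x) ((f ^^ k) y) < e" for k
    using compact_uniformly_continuous[OF _ \<open>compact X\<close>, of "f ^^ k"]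
      continuous_on_funpow[OF assms(2,3), of k] \<open>e > 0\<close>
    unfolding uniformly_continuous_on_def by (metis dist_commute)
  then obtain D where D: "\<And>k. D k > 0"
    "\<And>k x y. x \<in> X \<Longrightarrow> y \<in> X \<Longrightarrow> dist x y < D k \<Longrightarrow> dist ((f ^^ k) x) ((f ^^ k) y) < e"
    by metis
  show ?thesis
  proof (intro exI[of _ "Min (D ` {..N})"] conjI ballI allI impI)
    show "Min (D ` {..N}) > 0" using D(1) by (subst Min_gr_iff) auto
  next
    fix x y and k :: nat assume *: "x \<in> X" "y \<in> X" "k \<le> N" "dist x y < Min (D ` {..N})"
    then have "Min (D ` {..N}) \<le> D k" by (intro Min_le) auto
    then show "dist ((f ^^ k) x) ((f ^^ k) y) < e" using * D(2) by force
  qed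
qed

lemma minimal_uniform_spanning_set:
  fixes X :: "'a::metric_space set"
  assumes X: "compact X" and min: "minimal_homeomorphism X f" and "\<epsilon> > 0"
  shows "\<exists>M. finite M \<and> (\<forall>n. hausdorff_spanning X {f, id} n \<epsilon> M)"
proof -
  \<comment> \<open>The Hausdorff distances will be bounded by a non-strict inequality, while
    spanning asks for a strict one; hence some \<open>e\<close> strictly below
    \<open>\<epsilon>\<close>.\<close>
  define e where "e = \<epsilon> / 2"
  have e: "e > 0" "e < \<epsilon>" using \<open>\<epsilon> > 0\<close> by (auto simp: e_def)
  have fX: "continuous_on X f" "f ` X \<subseteq> X"
    using min by (auto simp: minimal_homeomorphism_def homeomorphism_def)
  note fnX = funpow_mem[OF fX(2)]
  obtain N where N: "\<forall>x\<in>X. \<forall>z\<in>X. \<exists>k\<le>N. dist ((f ^^ k) x) z < e"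
    using minimal_uniformly_dense_segments[OF X min e(1)] by blast
  obtain d where d: "d > 0"
    "\<forall>x\<in>X. \<forall>y\<in>X. \<forall>k\<le>N. dist x y < d \<longrightarrow> dist ((f ^^ k) x) ((f ^^ k) y) < e"
    using uniformly_equicontinuous_funpow[OF X fX e(1)] by blast
  obtain M where M: "finite M" "M \<subseteq> X" "X \<subseteq> (\<Union>y\<in>M. ball y d)"
    using seq_compact_imp_totally_bounded[OF compact_imp_seq_compact[OF X]] d(1) by meson
  \<comment> \<open>For \<open>i \<le> N\<close> the same exponent \<open>l = k\<close> works by the
    choice of \<open>d\<close>. For larger \<open>i\<close> the segment of \<open>y\<close> already
    contains its first \<open>N\<close> iterates, which come close to every point of
    \<open>X\<close>, in particular to \<open>(f ^^ k) x\<close>.\<close>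
  have follow: "\<exists>l\<le>i. dist ((f ^^ k) x) ((f ^^ l) y) \<le> e"
    if "x \<in> X" "y \<in> X" "dist x y < d" "k \<le> i" for x y k i
  proof (cases "i \<le> N")
    case True
    then have "dist ((f ^^ k) x) ((f ^^ k) y) < e" using that d(2) by auto
    then show ?thesis using \<open>k \<le> i\<close> less_imp_le by blast
  next
    case False
    obtain l where "l \<le> N" "dist ((f ^^ l) y) ((f ^^ k) x) < e"
      using N \<open>y \<in> X\<close> fnX[OF \<open>x \<in> X\<close>] by blast
    with False show ?thesis by (intro exI[of _ l]) (auto simp: dist_commute)
  qed
  have "hausdorff_spanning X {f, id} n \<epsilon> M" for n
    unfolding hausdorff_spanning_def
  proof (intro conjI ballI)
    fix x assume x: "x \<in> X"
    then obtain y where y: "y \<in> M" "dist x y < d" using M by (auto simp: dist_commute)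
    then have "y \<in> X" using M by blast
    have "hausdorff_dist (images {f, id} i x) (images {f, id} i y) \<le> e" for i
    proof (rule hausdorff_dist_le)
      show "\<exists>b\<in>images {f, id} i y. dist a b \<le> e" if "a \<in> images {f, id} i x" for a
        using that follow[OF x \<open>y \<in> X\<close> y(2)] by (force simp: images_insert_id)
      show "\<exists>a\<in>images {f, id} i x. dist a b \<le> e" if "b \<in> images {f, id} i y" for b
        using that follow[OF \<open>y \<in> X\<close> x] y(2) by (force simp: images_insert_id dist_commute)
    qed (auto simp: images_insert_id)
    then have "hausdorff_dist_upto {f, id} n x y < \<epsilon>"
      unfolding hausdorff_dist_upto_def using e(2) by (subst Max_less_iff) (auto intro: le_less_trans)
    then show "\<exists>y\<in>M. hausdorff_dist_upto {f, id} n x y < \<epsilon>" using y by blast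
  qed (use M in auto)
  then show ?thesis using M(1) by blast
qed

lemma bounded_ln_nat_rate:
  assumes "\<And>n. r n \<le> (K::nat)"
  shows "(\<lambda>n. ln (real (r n)) / real n) \<longlonglongrightarrow> 0"
proof (rule tendsto_sandwich)
  have ln_ge: "0 \<le> ln (real (r n))" for n
    \<comment> \<open>The case \<open>r n = 0\<close> is covered by the convention
      \<open>ln 0 = 0\<close>.\<close>
    by (cases "r n = 0") auto
  have ln_le: "ln (real (r n)) \<le> real K" for n
    using assms[of n] ln_bound[of "real (r n)"] by (cases "r n = 0") auto
  show "\<forall>\<^sub>F n in sequentially. 0 \<le> ln (real (r n)) / real n"
    using ln_ge by (simp add: always_eventually)
  show "\<forall>\<^sub>F n in sequentially. ln (real (r n)) / real n \<le> real K / real n"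
    using ln_le by (simp add: always_eventually divide_right_mono)
  show "(\<lambda>n. real K / real n) \<longlonglongrightarrow> 0"
    by (rule lim_const_over_n)
qed simp

theorem proposition4p4:
  fixes X :: "'a::metric_space set" and f :: "'a \<Rightarrow> 'a"
  assumes "compact X" and "X \<noteq> {}"
    and "minimal_homeomorphism X f"
  shows "hausdorff_entropy X {f, id} = 0"
proof -
  have "limsup (\<lambda>n. ereal (ln (real (min_spanning_card X {f, id} n \<epsilon>)) / real n)) = 0"
    if "\<epsilon> > 0" for \<epsilon>
  proof -
    obtain M where M: "finite M" "\<And>n. hausdorff_spanning X {f, id} n \<epsilon> M"
      using minimal_uniform_spanning_set[OF assms(1,3) \<open>\<epsilon> > 0\<close>] by blast
    have "min_spanning_card X {f, id} n \<epsilon> \<le> card M" for n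
      unfolding min_spanning_card_def using M by (intro Least_le) blast
    from bounded_ln_nat_rate[OF this]
    have "(\<lambda>n. ereal (ln (real (min_spanning_card X {f, id} n \<epsilon>)) / real n)) \<longlonglongrightarrow> 0"
      by (simp add: zero_ereal_def)
    then show ?thesis by (intro lim_imp_Limsup) auto
  qed
  then have "((\<lambda>\<epsilon>. limsup (\<lambda>n. ereal (ln (real (min_spanning_card X {f, id} n \<epsilon>)) / real n)))
      \<longlongrightarrow> 0) (at_right 0)"
    \<comment> \<open>The upper limit is exactly 0 for every positive \<open>\<epsilon>\<close>; the
      endpoint 1 is an arbitrary choice of right neighbourhood.\<close>
    by (intro tendsto_eventually) (auto simp: eventually_at_right_field intro: exI[of _ 1])
  then show ?thesis
    unfolding hausdorff_entropy_def by (intro tendsto_Lim) auto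
qed

end
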